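(* Let $A(\mathbb{D})$ be the disk-algebra. For every integer $n\ge 2$, $E_n(A(\mathbb{D}))=\mathrm{SL}_n(A(\mathbb{D}))$.
   Context: $\mathbb{D}$ is the open unit disk of $\mathbb{C}$. The disk-algebra $A(\mathbb{D})$ consists of all holomorphic functions on $\mathbb{D}$ which extend to continuous functions on the closed disk $\overline{\mathbb{D}}$ (with pointwise operations and the supremum norm). For a commutative unital ring $R$, an elementary $n\times n$ matrix over $R$ is a matrix with ones on the diagonal and zeros outside the diagonal, except for one off-diagonal entry, which may be an arbitrary element of $R$. $E_n(R)$ denotes the set of those $n\times n$ matrices which are representable as (finite) products of elementary matrices with entries in $R$. *)

theory Defs
  imports "HOL-Analysis.Complex_Analysis_Basics" "Jordan_Normal_Form.Determinant"
begin

(* An element is a function on the open unit disk. HOL functions are total, so the values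
   outside the disk are fixed to be 0; this makes equality of elements the same as
   equality of functions on the disk. *)
typedef disk_algebra =
  "{f :: complex \<Rightarrow> complex. f holomorphic_on ball 0 1 \<and>
      (\<exists>g. continuous_on (cball 0 1) g \<and> (\<forall>z\<in>ball 0 1. g z = f z)) \<and>
      (\<forall>z. z \<notin> ball 0 1 \<longrightarrow> f z = 0)}"
  morphisms disk_fun Disk_fun
proof (rule exI[of _ "\<lambda>_. 0"])
qed (auto intro!: exI[of _ "\<lambda>_. 0"] continuous_intros)

setup_lifting type_definition_disk_algebra

instantiation disk_algebra :: comm_ring_1
begin

lift_definition zero_disk_algebra :: disk_algebra is "\<lambda>_. 0"
  by (auto intro!: exI[of _ "\<lambda>_. 0"] continuous_intros)

lift_definition one_disk_algebra :: disk_algebra is "\<lambda>z. if z \<in> ball 0 1 then 1 else 0"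
proof -
  have "(\<lambda>z. if z \<in> ball 0 1 then 1 else 0 :: complex) holomorphic_on ball 0 1"
    by (rule holomorphic_transform[of "\<lambda>_. 1"]) auto
  then show "?thesis"
    by (auto intro!: exI[of _ "\<lambda>_. 1"] continuous_intros)
qed

lift_definition plus_disk_algebra :: "disk_algebra \<Rightarrow> disk_algebra \<Rightarrow> disk_algebra"
  is "\<lambda>f g z. f z + g z"
proof (elim CollectE conjE exE, intro CollectI conjI)
  fix f1 f2 g1 g2 :: "complex \<Rightarrow> complex"
  assume "continuous_on (cball 0 1) g1" "\<forall>z\<in>ball 0 1. g1 z = f1 z"
    "continuous_on (cball 0 1) g2" "\<forall>z\<in>ball 0 1. g2 z = f2 z"
  then show "\<exists>g. continuous_on (cball 0 1) g \<and> (\<forall>z\<in>ball 0 1. g z = f1 z + f2 z)"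
    by (intro exI[of _ "\<lambda>z. g1 z + g2 z"]) (auto intro!: continuous_intros)
qed (auto intro!: holomorphic_intros)

lift_definition minus_disk_algebra :: "disk_algebra \<Rightarrow> disk_algebra \<Rightarrow> disk_algebra"
  is "\<lambda>f g z. f z - g z"
proof (elim CollectE conjE exE, intro CollectI conjI)
  fix f1 f2 g1 g2 :: "complex \<Rightarrow> complex"
  assume "continuous_on (cball 0 1) g1" "\<forall>z\<in>ball 0 1. g1 z = f1 z"
    "continuous_on (cball 0 1) g2" "\<forall>z\<in>ball 0 1. g2 z = f2 z"
  then show "\<exists>g. continuous_on (cball 0 1) g \<and> (\<forall>z\<in>ball 0 1. g z = f1 z - f2 z)"
    by (intro exI[of _ "\<lambda>z. g1 z - g2 z"]) (auto intro!: continuous_intros)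
qed (auto intro!: holomorphic_intros)

lift_definition times_disk_algebra :: "disk_algebra \<Rightarrow> disk_algebra \<Rightarrow> disk_algebra"
  is "\<lambda>f g z. f z * g z"
proof (elim CollectE conjE exE, intro CollectI conjI)
  fix f1 f2 g1 g2 :: "complex \<Rightarrow> complex"
  assume "continuous_on (cball 0 1) g1" "\<forall>z\<in>ball 0 1. g1 z = f1 z"
    "continuous_on (cball 0 1) g2" "\<forall>z\<in>ball 0 1. g2 z = f2 z"
  then show "\<exists>g. continuous_on (cball 0 1) g \<and> (\<forall>z\<in>ball 0 1. g z = f1 z * f2 z)"
    by (intro exI[of _ "\<lambda>z. g1 z * g2 z"]) (auto intro!: continuous_intros)
qed (auto intro!: holomorphic_intros)

lift_definition uminus_disk_algebra :: "disk_algebra \<Rightarrow> disk_algebra" is "\<lambda>f z. - f z"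
proof (elim CollectE conjE exE, intro CollectI conjI)
  fix f g :: "complex \<Rightarrow> complex"
  assume "continuous_on (cball 0 1) g" "\<forall>z\<in>ball 0 1. g z = f z"
  then show "\<exists>g. continuous_on (cball 0 1) g \<and> (\<forall>z\<in>ball 0 1. g z = - f z)"
    by (intro exI[of _ "\<lambda>z. - g z"]) (auto intro!: continuous_intros)
qed (auto intro!: holomorphic_intros)

instance
proof
  fix a b c :: disk_algebra
  show "a * b * c = a * (b * c)" by transfer (simp add: mult.assoc)
  show "a * b = b * a" by transfer (simp add: mult.commute)
  show "1 * a = a" by transfer auto
  show "a + b + c = a + (b + c)" by transfer (simp add: add.assoc)
  show "a + b = b + a" by transfer (simp add: add.commute)
  show "0 + a = a" by transfer simp
  show "- a + a = 0" by transfer simp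
  show "a - b = a + - b" by transfer simp
  show "(a + b) * c = a * c + b * c" by transfer (simp add: distrib_right)
  show "(0::disk_algebra) \<noteq> 1" by transfer (auto simp: fun_eq_iff intro!: exI[of _ 0])
qed

end

(* addrow_mat n a k l is the identity matrix with a added to the entry in position (k, l). *)
definition elementary_mats :: "nat \<Rightarrow> 'a :: comm_ring_1 mat set" where
  "elementary_mats n = {addrow_mat n a k l | a k l. k < n \<and> l < n \<and> k \<noteq> l}"

definition E_mats :: "nat \<Rightarrow> 'a :: comm_ring_1 mat set" where
  "E_mats n = {foldr (*) As (1\<^sub>m n) | As. set As \<subseteq> elementary_mats n}"

definition SL_mats :: "nat \<Rightarrow> 'a :: comm_ring_1 mat set" where
  "SL_mats n = {A \<in> carrier_mat n n. det A = 1}"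

end

theory Submission
  imports Defs
begin

text \<open>The inclusion of \<open>E_n\<close> in \<open>SL_n\<close> holds over every commutative ring. For the other one, a matrix \<open>F\<close>
in \<open>SL_n\<close> of the disk algebra is joined to the constant matrix \<open>F(0)\<close> by the path of its dilates
\<open>F_t(z) = F(t z)\<close>, \<open>0 \<le> t \<le> 1\<close>. Dilation is a ring homomorphism, so the path stays in \<open>SL_n\<close>, and it
is continuous for the supremum norm because \<open>F\<close> is uniformly continuous on the closed disk. The
proof is thus the one showing that, in a commutative Banach algebra, a matrix connected to the
identity within \<open>SL_n\<close> is a product of elementary matrices.

Cut the path into short steps. Consecutive dilates differ by a factor \<open>G = F_s\<inverse> F_t\<close> which is so
close to the identity that all its leading principal minors are uniformly close to one
(\<open>leading_minors_unit_of_close_dilates\<close>). Such functions are units of the disk algebra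
(\<open>disk_algebra_unit\<close>), and a matrix whose leading minors are units can be reduced by row operations
to \<open>diag(det G, 1, \<dots>, 1)\<close> (\<open>elem_reducible_leading_minors\<close>); here \<open>det G = 1\<close>, so \<open>G\<close> is a product
of elementary matrices. At the start of the path stands a complex matrix of determinant one, which is
such a product by Gaussian elimination over a field (\<open>elem_reducible_field\<close>).\<close>

section \<open>Products of elementary matrices\<close>

lemma E_mats_one: "1\<^sub>m n \<in> E_mats n"
  unfolding E_mats_def by (auto intro!: exI[of _ "[]"])

lemma elementary_mats_carrier: "A \<in> elementary_mats n \<Longrightarrow> A \<in> carrier_mat n n"
  unfolding elementary_mats_def by auto

lemma foldr_elementary_carrier:
  "set As \<subseteq> elementary_mats n \<Longrightarrow> foldr (*) As (1\<^sub>m n) \<in> carrier_mat n n"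
proof (induction As)
  case (Cons A As)
  then show ?case using elementary_mats_carrier[of A n] by auto
qed auto

lemma E_mats_carrier: "A \<in> E_mats n \<Longrightarrow> A \<in> carrier_mat n n"
  unfolding E_mats_def using foldr_elementary_carrier by auto

lemma elementary_mult_E_mats:
  assumes "A \<in> elementary_mats n" "B \<in> E_mats n"
  shows "A * B \<in> E_mats n"
proof -
  from assms(2) obtain As where "B = foldr (*) As (1\<^sub>m n)" "set As \<subseteq> elementary_mats n"
    unfolding E_mats_def by auto
  with assms(1) show ?thesis unfolding E_mats_def
    by (auto intro!: exI[of _ "A # As"])
qed

lemma E_mats_induct [consumes 1, case_names one mult]:
  assumes "A \<in> E_mats n" "P (1\<^sub>m n)"
    "\<And>a k l B. k < n \<Longrightarrow> l < n \<Longrightarrow> k \<noteq> l \<Longrightarrow> B \<in> E_mats n \<Longrightarrow> P B \<Longrightarrow> P (addrow_mat n a k l * B)"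
  shows "P A"
proof -
  from assms(1) obtain As where A: "A = foldr (*) As (1\<^sub>m n)" and As: "set As \<subseteq> elementary_mats n"
    unfolding E_mats_def by auto
  from As have "P (foldr (*) As (1\<^sub>m n)) \<and> foldr (*) As (1\<^sub>m n) \<in> E_mats n"
  proof (induction As)
    case Nil
    then show ?case using assms(2) E_mats_one by simp
  next
    case (Cons X As)
    then have X: "X \<in> elementary_mats n" by simp
    then obtain a k l where "X = addrow_mat n a k l" "k < n" "l < n" "k \<noteq> l"
      unfolding elementary_mats_def by blast
    then show ?case using Cons assms(3) elementary_mult_E_mats[OF X] by simp
  qed
  with A show ?thesis by simp
qed

lemma E_mats_mult:
  assumes "A \<in> E_mats n" "B \<in> E_mats n"
  shows "A * B \<in> E_mats n"
  using assms(1)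
proof (induction rule: E_mats_induct)
  case one
  then show ?case using assms(2) E_mats_carrier[OF assms(2)] by simp
next
  case (mult a k l M)
  have "addrow_mat n a k l * M * B = addrow_mat n a k l * (M * B)"
    using E_mats_carrier[OF assms(2)] E_mats_carrier[OF mult(4)]
    by (intro assoc_mult_mat[of _ n n _ n _ n]) auto
  then show ?case using mult elementary_mult_E_mats[of "addrow_mat n a k l" n "M * B"]
    unfolding elementary_mats_def by auto
qed

lemma addrow_mat_in_E_mats:
  assumes "k < n" "l < n" "k \<noteq> l"
  shows "addrow_mat n a k l \<in> E_mats n"
  using elementary_mult_E_mats[OF _ E_mats_one, of "addrow_mat n a k l" n] assms
  unfolding elementary_mats_def by (auto simp: right_mult_one_mat[of _ n])

lemma addrow_in_E_mats:
  assumes "A \<in> E_mats n" "k < n" "l < n" "k \<noteq> l"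
  shows "addrow a k l A \<in> E_mats n"
  using E_mats_mult[OF addrow_mat_in_E_mats[OF assms(2-4)] assms(1)]
    addrow_mat[OF E_mats_carrier[OF assms(1)] assms(3)] by metis

lemma E_mats_subset_SL_mats: "E_mats n \<subseteq> SL_mats n"
proof
  fix A :: "'a::comm_ring_1 mat"
  assume "A \<in> E_mats n"
  then show "A \<in> SL_mats n"
  proof (induction rule: E_mats_induct)
    case one
    then show ?case by (simp add: SL_mats_def)
  next
    case (mult a k l B)
    then have "B \<in> carrier_mat n n" "det B = 1" by (auto simp: SL_mats_def)
    then show ?case using mult(3) unfolding SL_mats_def
      by (auto simp: det_mult[of _ n] det_addrow_mat)
  qed
qed

lemma det_E_mats: "A \<in> E_mats n \<Longrightarrow> det A = 1"
  using E_mats_subset_SL_mats unfolding SL_mats_def by blast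

text \<open>Used to transport a factorization over the complex numbers to the constants of the disk algebra.\<close>
lemma (in comm_ring_hom) hom_E_mats:
  assumes "A \<in> E_mats n"
  shows "map_mat hom A \<in> E_mats n"
  using assms
proof (induction rule: E_mats_induct)
  case one
  then show ?case by (simp add: mat_hom_one E_mats_one)
next
  case (mult a k l B)
  have "map_mat hom (addrow_mat n a k l) = addrow_mat n (hom a) k l"
    by (rule eq_matI) (auto simp: hom_distribs)
  then have "map_mat hom (addrow_mat n a k l * B) = addrow_mat n (hom a) k l * map_mat hom B"
    using mat_hom_mult[OF addrow_mat_carrier E_mats_carrier[OF mult(4)], of a k l] by simp
  then show ?case using mult addrow_mat_in_E_mats E_mats_mult by metis
qed

section \<open>Elimination over a commutative ring\<close>

lemma E_mats_block_one:
  assumes "A \<in> E_mats n"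
  shows "four_block_mat A (0\<^sub>m n 1) (0\<^sub>m 1 n) (1\<^sub>m 1) \<in> E_mats (Suc n)"
  using assms
proof (induction rule: E_mats_induct)
  case one
  have "four_block_mat (1\<^sub>m n) (0\<^sub>m n 1) (0\<^sub>m 1 n) (1\<^sub>m 1) = 1\<^sub>m (Suc n)"
    by (rule eq_matI) auto
  then show ?case using E_mats_one by metis
next
  case (mult a k l B)
  let ?b = "\<lambda>A. four_block_mat A (0\<^sub>m n 1) (0\<^sub>m 1 n) (1\<^sub>m 1)"
  have "?b (addrow_mat n a k l) = addrow_mat (Suc n) a k l"
    using mult(1-3) by (intro eq_matI) auto
  moreover have "?b (addrow_mat n a k l) * ?b B = ?b (addrow_mat n a k l * B)"
    using E_mats_carrier[OF mult(4)]
    by (subst mult_four_block_mat[of _ n n _ 1 _ 1 _ _ n _ 1]) auto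
  ultimately show ?case
    using mult E_mats_mult[OF addrow_mat_in_E_mats[of k "Suc n" l a] mult(5)] by simp
qed

lemma lower_block_in_E_mats:
  assumes "r \<in> carrier_mat 1 n"
  shows "four_block_mat (1\<^sub>m n) (0\<^sub>m n 1) r (1\<^sub>m 1) \<in> E_mats (Suc n)"
proof -
  define L where "L k = mat (Suc n) (Suc n) (\<lambda>(i, j).
    if i = j then 1 else if i = n \<and> j < k then r $$ (0, j) else 0)" for k
  have "k \<le> n \<Longrightarrow> L k \<in> E_mats (Suc n)" for k
  proof (induction k)
    case 0
    have "L 0 = 1\<^sub>m (Suc n)" unfolding L_def by (rule eq_matI) auto
    then show ?case by (simp add: E_mats_one)
  next
    case (Suc k)
    have "L (Suc k) = addrow (r $$ (0, k)) n k (L k)"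
      unfolding L_def using Suc.prems by (intro eq_matI) (auto simp: less_Suc_eq)
    then show ?case using Suc by (auto intro!: addrow_in_E_mats)
  qed
  moreover have "L n = four_block_mat (1\<^sub>m n) (0\<^sub>m n 1) r (1\<^sub>m 1)"
    unfolding L_def using assms by (intro eq_matI) (auto simp: less_Suc_eq)
  ultimately show ?thesis by (metis order_refl)
qed

lemma upper_block_in_E_mats:
  assumes "c \<in> carrier_mat n 1"
  shows "four_block_mat (1\<^sub>m n) c (0\<^sub>m 1 n) (1\<^sub>m 1) \<in> E_mats (Suc n)"
proof -
  define U where "U k = mat (Suc n) (Suc n) (\<lambda>(i, j).
    if i = j then 1 else if j = n \<and> i < k then c $$ (i, 0) else 0)" for k
  have "k \<le> n \<Longrightarrow> U k \<in> E_mats (Suc n)" for k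
  proof (induction k)
    case 0
    have "U 0 = 1\<^sub>m (Suc n)" unfolding U_def by (rule eq_matI) auto
    then show ?case by (simp add: E_mats_one)
  next
    case (Suc k)
    have "U (Suc k) = addrow (c $$ (k, 0)) k n (U k)"
      unfolding U_def using Suc.prems by (intro eq_matI) (auto simp: less_Suc_eq)
    then show ?case using Suc by (auto intro!: addrow_in_E_mats)
  qed
  moreover have "U n = four_block_mat (1\<^sub>m n) c (0\<^sub>m 1 n) (1\<^sub>m 1)"
    unfolding U_def using assms by (intro eq_matI) (auto simp: less_Suc_eq)
  ultimately show ?thesis by (metis order_refl)
qed

text \<open>The determinant is multiplicative and products of elementary matrices have determinant one, so
for \<open>n > 0\<close> the scalar \<open>u\<close> below can only be \<open>det A\<close>. Leaving it free lets the inductions run on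
matrices of arbitrary determinant, such as the leading blocks of a matrix in \<open>SL\<close>.\<close>
definition elem_reducible :: "nat \<Rightarrow> 'a :: comm_ring_1 mat \<Rightarrow> bool" where
  "elem_reducible n A \<longleftrightarrow> (\<exists>E\<in>E_mats n. \<exists>u. A = E * multrow_mat n 0 u)"

lemma elem_reducible_mult:
  assumes "E \<in> E_mats n" "elem_reducible n A"
  shows "elem_reducible n (E * A)"
proof -
  from assms(2) obtain F u where F: "F \<in> E_mats n" "A = F * multrow_mat n 0 u"
    unfolding elem_reducible_def by auto
  then have "E * A = (E * F) * multrow_mat n 0 u"
    using E_mats_carrier[OF assms(1)] E_mats_carrier[OF F(1)]
    by (simp add: assoc_mult_mat[of _ n n _ n _ n])
  then show ?thesis unfolding elem_reducible_def using E_mats_mult[OF assms(1) F(1)] by auto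
qed

lemma elem_reducible_addrowD:
  assumes "elem_reducible n (addrow a k l A)" "A \<in> carrier_mat n n" "k < n" "l < n" "k \<noteq> l"
  shows "elem_reducible n A"
proof -
  have "A = addrow (-a) k l (addrow a k l A)"
    using assms(2-5) by (intro eq_matI) auto
  also have "\<dots> = addrow_mat n (-a) k l * addrow a k l A"
    using assms by (intro addrow_mat) auto
  finally show ?thesis
    using elem_reducible_mult[OF addrow_mat_in_E_mats[OF assms(3-5), of "-a"] assms(1)] by simp
qed

lemma elem_reducible_SL_mats:
  assumes "A \<in> SL_mats n" "elem_reducible n A" "n > 0"
  shows "A \<in> E_mats n"
proof -
  from assms(2) obtain E u where E: "E \<in> E_mats n" "A = E * multrow_mat n 0 u"
    unfolding elem_reducible_def by auto
  from E(1) have E': "E \<in> carrier_mat n n" "det E = 1"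
    using E_mats_subset_SL_mats by (auto simp: SL_mats_def)
  have "1 = det A" using assms(1) by (simp add: SL_mats_def)
  also have "\<dots> = u" using E' E(2) assms(3) by (simp add: det_mult[of _ n] det_multrow_mat)
  finally have "multrow_mat n 0 u = 1\<^sub>m n" by (intro eq_matI) auto
  then show ?thesis using E E' by simp
qed

text \<open>Whitehead's lemma: \<open>diag(w, v)\<close> is a product of elementary matrices when \<open>v w = 1\<close>, and it carries
\<open>diag(u v, 1)\<close> to \<open>diag(u, v)\<close>. It moves a unit from the last diagonal entry into the first one.\<close>
lemma whitehead_diagonal:
  fixes u v w :: "'a :: comm_ring_1"
  assumes vw: "v * w = 1" and n: "n > 0"
  shows "elem_reducible (Suc n) (four_block_mat (multrow_mat n 0 u) (0\<^sub>m n 1) (0\<^sub>m 1 n) (mat 1 1 (\<lambda>_. v)))"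
    (is "elem_reducible _ ?D")
proof -
  let ?M = "multrow_mat (Suc n) 0 (u * v)"
  let ?N = "addrow (w - 1) 0 n (addrow 1 n 0 (addrow (-1) 0 n ?M))"
  have pivot: "(w - 1) * (u * v) + u * v = u"
    using arg_cong[OF vw, of "(*) u"] by (simp add: algebra_simps)
  \<comment> \<open>On the rows 0 and n, diag(u v, 1) becomes in turn (u v, -1; 0, 1), (u v, -1; u v, 0), (u, -1; u v, 0), (u, -1; 0, v) and finally diag(u, v).\<close>
  have "?D = addrow w 0 n (addrow (- v) n 0 ?N)"
  proof (rule eq_matI)
    fix i j assume "i < dim_row (addrow w 0 n (addrow (- v) n 0 ?N))"
      "j < dim_col (addrow w 0 n (addrow (- v) n 0 ?N))"
    then show "?D $$ (i, j) = addrow w 0 n (addrow (- v) n 0 ?N) $$ (i, j)"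
      using n vw by (auto simp: less_Suc_eq pivot mult.commute)
  qed auto
  moreover have red: "elem_reducible (Suc n) (addrow a k l A)"
    if "elem_reducible (Suc n) A" "A \<in> carrier_mat (Suc n) (Suc n)" "k < Suc n" "l < Suc n" "k \<noteq> l"
    for a :: 'a and A k l
    using elem_reducible_mult[OF addrow_mat_in_E_mats[OF that(3-5)] that(1)] addrow_mat[OF that(2,4)]
    by metis
  have "elem_reducible (Suc n) ?M"
    unfolding elem_reducible_def by (rule bexI[OF _ E_mats_one]) (auto intro!: exI[of _ "u * v"] simp: left_mult_one_mat[of _ "Suc n"])
  then have "elem_reducible (Suc n) (addrow w 0 n (addrow (- v) n 0 ?N))"
    using n by (intro red) auto
  ultimately show ?thesis by simp
qed

text \<open>If the block \<open>B\<close> and the whole matrix are invertible, then so is the Schur complement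
\<open>e = d - r B\<inverse> c\<close>, since the determinant of the matrix is \<open>det B\<close> times \<open>e\<close>. Hence the last row and
the last column can both be cleared by operations on rows: \<open>r = (r B\<inverse>) B\<close> is a combination of the
rows of \<open>B\<close>, and \<open>c\<close> is a multiple of \<open>e\<close>. Whitehead's lemma takes care of the remaining diagonal
entry.\<close>
lemma elem_reducible_block_step:
  fixes B c r d :: "'a :: comm_ring_1 mat"
  assumes n: "n > 0"
    and B: "B \<in> carrier_mat n n" "elem_reducible n B" "det B dvd 1"
    and c: "c \<in> carrier_mat n 1" and r: "r \<in> carrier_mat 1 n" and d: "d \<in> carrier_mat 1 1"
    and A: "det (four_block_mat B c r d) dvd 1"
  shows "elem_reducible (Suc n) (four_block_mat B c r d)"
proof -
  obtain b where b: "1 = det B * b" using B(3) by (auto elim: dvdE)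
  \<comment> \<open>The inverse of B, by Cramer's rule.\<close>
  define Bi where "Bi = b \<cdot>\<^sub>m adj_mat B"
  have Bi: "Bi \<in> carrier_mat n n" "Bi * B = 1\<^sub>m n"
  proof -
    show "Bi \<in> carrier_mat n n" using adj_mat(1)[OF B(1)] by (simp add: Bi_def)
    have "Bi * B = b \<cdot>\<^sub>m (adj_mat B * B)"
      unfolding Bi_def using adj_mat(1)[OF B(1)] B(1) by (intro mult_smult_assoc_mat)
    also have "\<dots> = 1\<^sub>m n" using b by (intro eq_matI) (auto simp: adj_mat(3)[OF B(1)] mult.commute)
    finally show "Bi * B = 1\<^sub>m n" .
  qed
  define x where "x = r * Bi"
  have x: "x \<in> carrier_mat 1 n" "x * B = r"
    using Bi r B(1) by (auto simp: x_def assoc_mult_mat[of _ 1 n _ n _ n])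
  define e where "e = d - x * c"
  have e: "e \<in> carrier_mat 1 1" using d x c by (auto simp: e_def)
  define v where "v = e $$ (0, 0)"
  have ev: "e = mat 1 1 (\<lambda>_. v)" using e by (intro eq_matI) (auto simp: v_def)
  let ?L = "four_block_mat (1\<^sub>m n) (0\<^sub>m n 1) x (1\<^sub>m 1)"
  let ?T = "four_block_mat B c (0\<^sub>m 1 n) e"
  have "?L * ?T = four_block_mat B c r (x * c + e)"
    using x B(1) c e by (subst mult_four_block_mat[of _ n n _ 1 _ 1 _ _ n _ 1]) auto
  also have "x * c + e = d" using x c d by (intro eq_matI) (auto simp: e_def)
  finally have LT: "?L * ?T = four_block_mat B c r d" .
  have L: "?L \<in> E_mats (Suc n)" using lower_block_in_E_mats[OF x(1)] .
  have Tc: "?T \<in> carrier_mat (Suc n) (Suc n)"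
    using four_block_carrier_mat[OF B(1) e, of c "0\<^sub>m 1 n"] by simp
  \<comment> \<open>Transposition turns the zero block into the upper right one, where the block formula for determinants holds over any commutative ring.\<close>
  have "det ?T = det (transpose_mat ?T)" using det_transpose[OF Tc] by simp
  also have "transpose_mat ?T = four_block_mat (transpose_mat B) (0\<^sub>m n 1) (transpose_mat c) (transpose_mat e)"
    using B(1) c e by (subst transpose_four_block_mat[of _ n n _ 1 _ 1]) auto
  also have "det \<dots> = det (transpose_mat B) * det (transpose_mat e)"
    using B(1) c e by (intro det_four_block_mat_upper_right_zero_col) auto
  also have "\<dots> = det B * v"
    using det_transpose[OF B(1)] det_transpose[OF e] by (simp add: ev det_single)
  finally have "det ?T = det B * v" .
  moreover have "det (four_block_mat B c r d) = det ?T"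
    using det_mult[OF E_mats_carrier[OF L] Tc] unfolding LT det_E_mats[OF L] by simp
  ultimately have "v dvd 1" using A by (metis dvd_mult_right)
  then obtain w where vw: "v * w = 1" by (metis dvdE)
  obtain E u where E: "E \<in> E_mats n" "B = E * multrow_mat n 0 u"
    using B(2) unfolding elem_reducible_def by auto
  let ?U = "four_block_mat (1\<^sub>m n) (w \<cdot>\<^sub>m c) (0\<^sub>m 1 n) (1\<^sub>m 1)"
  let ?E = "four_block_mat E (0\<^sub>m n 1) (0\<^sub>m 1 n) (1\<^sub>m 1)"
  let ?D = "four_block_mat (multrow_mat n 0 u) (0\<^sub>m n 1) (0\<^sub>m 1 n) e"
  have "?E * ?D = four_block_mat B (0\<^sub>m n 1) (0\<^sub>m 1 n) e"
    using E_mats_carrier[OF E(1)] e E(2)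
    by (subst mult_four_block_mat[of _ n n _ 1 _ 1 _ _ n _ 1]) auto
  moreover have "?U * four_block_mat B (0\<^sub>m n 1) (0\<^sub>m 1 n) e = ?T"
  proof -
    have "w \<cdot>\<^sub>m c * e = c"
    proof (rule eq_matI)
      fix i j assume "i < dim_row c" "j < dim_col c"
      then have ij: "i < n" "j = 0" using c by auto
      then have "(w \<cdot>\<^sub>m c * e) $$ (i, j) = w * c $$ (i, 0) * v"
        using c by (simp add: ev scalar_prod_def)
      also have "\<dots> = c $$ (i, 0) * (v * w)" by (simp add: ac_simps)
      finally show "(w \<cdot>\<^sub>m c * e) $$ (i, j) = c $$ (i, j)" using ij vw by simp
    qed (use c e in auto)
    then show ?thesis
      using B(1) c e by (subst mult_four_block_mat[of _ n n _ 1 _ 1 _ _ n _ 1]) auto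
  qed
  moreover have "elem_reducible (Suc n) (?L * (?U * (?E * ?D)))"
    using whitehead_diagonal[OF vw n, of u] c
    by (intro elem_reducible_mult L E_mats_block_one E(1) upper_block_in_E_mats) (auto simp: ev)
  ultimately show ?thesis using LT by simp
qed

lemma elem_reducible_one:
  assumes "A \<in> carrier_mat 1 1"
  shows "elem_reducible 1 A"
proof -
  have "A = 1\<^sub>m 1 * multrow_mat 1 0 (A $$ (0, 0))"
    using assms by (intro eq_matI) auto
  then show ?thesis unfolding elem_reducible_def using E_mats_one by metis
qed

definition leading_block :: "nat \<Rightarrow> 'a mat \<Rightarrow> 'a mat" where
  "leading_block k A = mat k k (\<lambda>ij. A $$ ij)"

text \<open>Gaussian elimination without exchange of rows: each pivot is a quotient of two consecutive
leading minors. The hypothesis passes to the leading block of size \<open>n - 1\<close> as it stands, so the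
induction peels off the last row and column.\<close>
lemma elem_reducible_leading_minors:
  assumes "A \<in> carrier_mat n n" "n > 0"
    and "\<And>k. 0 < k \<Longrightarrow> k \<le> n \<Longrightarrow> det (leading_block k A) dvd 1"
  shows "elem_reducible n A"
  using assms(2,1,3)
proof (induction n arbitrary: A rule: nat_induct_non_zero)
  case 1
  then show ?case by (intro elem_reducible_one)
next
  case (Suc n)
  obtain B c r d where sp: "split_block A n n = (B, c, r, d)" by (metis prod_cases4)
  have dims: "dim_row A = n + 1" "dim_col A = n + 1" using Suc.prems(1) by auto
  note bl = split_block[OF sp dims]
  have B: "B = leading_block n A"
    using sp bl(1) by (auto simp: split_block_def Let_def leading_block_def)
  have lead: "leading_block k B = leading_block k A" if "k \<le> n" for k
    using that unfolding B leading_block_def by (intro eq_matI) auto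
  have "leading_block (Suc n) A = A"
    using Suc.prems(1) unfolding leading_block_def by (intro eq_matI) auto
  then have "det A dvd 1" using Suc.prems(2)[of "Suc n"] by simp
  moreover have "det B dvd 1" using Suc.prems(2)[of n] Suc.hyps by (simp add: B)
  moreover have "elem_reducible n B"
    using Suc.prems(2) by (intro Suc.IH bl(1)) (auto simp: lead)
  ultimately show ?case using elem_reducible_block_step[OF Suc.hyps bl(1) _ _ bl(2-4)] bl(5) by simp
qed

text \<open>Over a field a pivot is always available: if the last column has a nonzero entry outside the
corner, one row operation makes the corner entry one; otherwise the corner entry is nonzero and can
first be copied upwards. Once the corner entry is one, the last column is cleared before the last
row, so that the leading block inherits the nonzero determinant.\<close>
lemma elem_reducible_field:
  fixes A :: "'a :: field mat"
  assumes "A \<in> carrier_mat n n" "n > 0" "det A \<noteq> 0"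
  shows "elem_reducible n A"
  using assms(2,1,3)
proof (induction n arbitrary: A rule: nat_induct_non_zero)
  case 1
  then show ?case by (intro elem_reducible_one)
next
  case (Suc n)
  have corner_one: "elem_reducible (Suc n) A"
    if A: "A \<in> carrier_mat (Suc n) (Suc n)" "det A \<noteq> 0" and one: "A $$ (n, n) = 1" for A :: "'a mat"
  proof -
    obtain B c r d where sp: "split_block A n n = (B, c, r, d)" by (metis prod_cases4)
    have dims: "dim_row A = n + 1" "dim_col A = n + 1" using A(1) by auto
    note bl = split_block[OF sp dims]
    have d: "d = 1\<^sub>m 1" 
      using sp one bl(4) A(1) by (intro eq_matI) (auto simp: split_block_def Let_def)
    let ?B = "B - c * r"
    let ?M = "four_block_mat ?B (0\<^sub>m n 1) r d"
    let ?U = "four_block_mat (1\<^sub>m n) c (0\<^sub>m 1 n) (1\<^sub>m 1)"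
    have Bc: "?B \<in> carrier_mat n n" using bl by auto
    have "B - c * r + c * r = B" using bl(1-3) by (intro eq_matI) auto
    then have UM: "?U * ?M = A" using bl Bc d
      by (subst mult_four_block_mat[of _ n n _ 1 _ 1 _ _ n _ 1]) auto
    have U: "?U \<in> E_mats (Suc n)" using upper_block_in_E_mats[OF bl(2)] .
    have Mc: "?M \<in> carrier_mat (Suc n) (Suc n)"
      using four_block_carrier_mat[OF Bc bl(4), of "0\<^sub>m n 1" r] by simp
    have "det A = det ?M" using det_mult[OF E_mats_carrier[OF U] Mc] unfolding UM det_E_mats[OF U] by simp
    moreover have "det ?M = det ?B" using Bc bl(3,4)
      by (subst det_four_block_mat_upper_right_zero_col[of _ n]) (auto simp: d)
    ultimately have nz: "det ?B \<noteq> 0" "det ?M \<noteq> 0" using A(2) by auto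
    have "elem_reducible (Suc n) ?M"
      using nz by (intro elem_reducible_block_step Suc.hyps Bc bl Suc.IH) (auto simp: dvd_field_iff)
    then show ?thesis using elem_reducible_mult[OF U] UM by metis
  qed
  have off_corner: "elem_reducible (Suc n) A"
    if A: "A \<in> carrier_mat (Suc n) (Suc n)" "det A \<noteq> 0" and i: "i < n" "A $$ (i, n) \<noteq> 0"
    for A :: "'a mat" and i
  proof -
    let ?a = "(1 - A $$ (n, n)) / A $$ (i, n)"
    have "elem_reducible (Suc n) (addrow ?a n i A)"
      using A i by (intro corner_one) (auto simp: det_addrow[of _ "Suc n"])
    then show ?thesis using A i by (elim elem_reducible_addrowD) auto
  qed
  show ?case
  proof (cases "\<exists>i<n. A $$ (i, n) \<noteq> 0")
    case True
    then show ?thesis using off_corner[OF Suc.prems] by auto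
  next
    case False
    have "A $$ (n, n) \<noteq> 0"
    proof
      assume "A $$ (n, n) = 0"
      with False have z: "A $$ (i, n) = 0" if "i < Suc n" for i using that by (auto simp: less_Suc_eq)
      have "det A = (\<Sum>i<Suc n. A $$ (i, n) * cofactor A i n)"
        using Suc.prems(1) by (intro laplace_expansion_column) auto
      also have "\<dots> = 0" using z by (intro sum.neutral) auto
      finally show False using Suc.prems(2) by simp
    qed
    then have "elem_reducible (Suc n) (addrow 1 0 n A)"
      using Suc.prems Suc.hyps False by (intro off_corner[of _ 0]) (auto simp: det_addrow[of _ "Suc n"])
    then show ?thesis using Suc.prems Suc.hyps by (elim elem_reducible_addrowD) auto
  qed
qed

section \<open>Homomorphisms and units of the disk algebra\<close>

text \<open>The continuous extension to the closed disk. Its values outside the closed disk are arbitrary.\<close>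
definition disk_ext :: "disk_algebra \<Rightarrow> complex \<Rightarrow> complex" where
  "disk_ext f = (SOME g. continuous_on (cball 0 1) g \<and> (\<forall>z\<in>ball 0 1. g z = disk_fun f z))"

lemma
  shows continuous_on_disk_ext: "continuous_on (cball 0 1) (disk_ext f)"
    and disk_ext_eq: "z \<in> ball 0 1 \<Longrightarrow> disk_ext f z = disk_fun f z"
proof -
  have "\<exists>g. continuous_on (cball 0 1) g \<and> (\<forall>z\<in>ball 0 1. g z = disk_fun f z)"
    using disk_fun[of f] by auto
  from someI_ex[OF this] show "continuous_on (cball 0 1) (disk_ext f)"
    "z \<in> ball 0 1 \<Longrightarrow> disk_ext f z = disk_fun f z"
    unfolding disk_ext_def by auto
qed

lemma holomorphic_on_disk_ext: "disk_ext f holomorphic_on ball 0 1"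
  using disk_fun[of f] by (auto intro: holomorphic_transform simp: disk_ext_eq)

lemma disk_algebra_eqI:
  assumes "\<And>z. z \<in> ball 0 1 \<Longrightarrow> disk_fun f z = disk_fun g z"
  shows "f = g"
proof -
  have "disk_fun f z = disk_fun g z" for z
    using assms[of z] disk_fun[of f] disk_fun[of g] by (cases "z \<in> ball 0 1") auto
  then show ?thesis by (simp add: disk_fun_inject[symmetric] fun_eq_iff)
qed

definition disk_of :: "(complex \<Rightarrow> complex) \<Rightarrow> disk_algebra" where
  "disk_of g = Disk_fun (\<lambda>z. if z \<in> ball 0 1 then g z else 0)"

lemma disk_fun_disk_of:
  assumes "continuous_on (cball 0 1) g" "g holomorphic_on ball 0 1" "z \<in> ball 0 1"
  shows "disk_fun (disk_of g) z = g z"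
proof -
  have "(\<lambda>z. if z \<in> ball 0 1 then g z else 0) holomorphic_on ball 0 1"
    by (rule holomorphic_transform[OF assms(2)]) auto
  then show ?thesis using assms unfolding disk_of_def
    by (subst Disk_fun_inverse) auto
qed

lemma comm_ring_hom_eval:
  assumes "z \<in> ball 0 1"
  shows "comm_ring_hom (\<lambda>f. disk_fun f z)"
  using assms
  by unfold_locales (auto simp: plus_disk_algebra.rep_eq times_disk_algebra.rep_eq
      zero_disk_algebra.rep_eq one_disk_algebra.rep_eq)

text \<open>Evaluations at points of the disk separate the elements of the disk algebra; a map into it is
therefore a ring homomorphism as soon as its composition with each evaluation is one.\<close>
lemma comm_ring_hom_pointwise:
  assumes "\<And>a z. z \<in> ball 0 1 \<Longrightarrow> disk_fun (h a) z = e z a"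
    and "\<And>z. z \<in> ball 0 1 \<Longrightarrow> comm_ring_hom (e z)"
  shows "comm_ring_hom h"
proof
  show "h (x + y) = h x + h y" for x y
  proof (rule disk_algebra_eqI)
    fix z :: complex assume z: "z \<in> ball 0 1"
    interpret comm_ring_hom "e z" using assms(2)[OF z] .
    show "disk_fun (h (x + y)) z = disk_fun (h x + h y) z"
      by (simp add: plus_disk_algebra.rep_eq assms(1)[OF z] hom_distribs)
  qed
  show "h (x * y) = h x * h y" for x y
  proof (rule disk_algebra_eqI)
    fix z :: complex assume z: "z \<in> ball 0 1"
    interpret comm_ring_hom "e z" using assms(2)[OF z] .
    show "disk_fun (h (x * y)) z = disk_fun (h x * h y) z"
      by (simp add: times_disk_algebra.rep_eq assms(1)[OF z] hom_distribs)
  qed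
  show "h 1 = 1"
  proof (rule disk_algebra_eqI)
    fix z :: complex assume z: "z \<in> ball 0 1"
    interpret comm_ring_hom "e z" using assms(2)[OF z] .
    show "disk_fun (h 1) z = disk_fun 1 z"
      using z by (simp add: one_disk_algebra.rep_eq assms(1))
  qed
  show "h 0 = 0"
  proof (rule disk_algebra_eqI)
    fix z :: complex assume z: "z \<in> ball 0 1"
    interpret comm_ring_hom "e z" using assms(2)[OF z] .
    show "disk_fun (h 0) z = disk_fun 0 z"
      using z by (simp add: zero_disk_algebra.rep_eq assms(1))
  qed
qed

definition disk_const :: "complex \<Rightarrow> disk_algebra" where
  "disk_const c = disk_of (\<lambda>_. c)"

lemma disk_fun_disk_const: "z \<in> ball 0 1 \<Longrightarrow> disk_fun (disk_const c) z = c"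
  unfolding disk_const_def by (intro disk_fun_disk_of) auto

lemma comm_ring_hom_disk_const: "comm_ring_hom disk_const"
  by (rule comm_ring_hom_pointwise[where e = "\<lambda>_ c. c"], simp add: disk_fun_disk_const)
     (unfold_locales, auto)

definition dilate :: "real \<Rightarrow> disk_algebra \<Rightarrow> disk_algebra" where
  "dilate t f = disk_of (\<lambda>z. disk_ext f (of_real t * z))"

lemma dilate_in_ball:
  fixes z :: complex
  assumes "t \<in> {0..1}" "z \<in> ball 0 1"
  shows "of_real t * z \<in> ball 0 1"
proof -
  have "\<bar>t\<bar> * norm z \<le> 1 * norm z" using assms by (intro mult_right_mono) auto
  then show ?thesis using assms by (simp add: norm_mult)
qed

lemma disk_fun_dilate:
  assumes t: "t \<in> {0..1}" and z: "z \<in> ball 0 1"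
  shows "disk_fun (dilate t f) z = disk_fun f (of_real t * z)"
proof -
  have "(\<lambda>z. of_real t * z) ` cball 0 1 \<subseteq> cball (0 :: complex) 1"
  proof (intro image_subsetI)
    fix z :: complex assume "z \<in> cball 0 1"
    then have "\<bar>t\<bar> * norm z \<le> 1 * 1" using t by (intro mult_mono) auto
    then show "of_real t * z \<in> cball 0 1" by (simp add: norm_mult)
  qed
  then have "continuous_on (cball 0 1) (\<lambda>z. disk_ext f (of_real t * z))"
    by (intro continuous_on_compose2[OF continuous_on_disk_ext] continuous_intros)
  moreover have "(disk_ext f \<circ> (\<lambda>z. of_real t * z)) holomorphic_on ball 0 1"
    using dilate_in_ball[OF t]
    by (intro holomorphic_on_compose_gen[OF _ holomorphic_on_disk_ext] holomorphic_intros) blast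
  ultimately show ?thesis
    unfolding dilate_def using z dilate_in_ball[OF t z]
    by (subst disk_fun_disk_of) (auto simp: o_def disk_ext_eq)
qed

lemma comm_ring_hom_dilate:
  assumes "t \<in> {0..1}"
  shows "comm_ring_hom (dilate t)"
  by (rule comm_ring_hom_pointwise[where e = "\<lambda>z f. disk_fun f (of_real t * z)"])
     (use assms disk_fun_dilate comm_ring_hom_eval dilate_in_ball in auto)

text \<open>The bound persists on the closed disk, so the extension has no zero there and its reciprocal is
again continuous up to the boundary.\<close>
lemma disk_algebra_unit:
  assumes near: "\<And>z. z \<in> ball 0 1 \<Longrightarrow> dist (disk_fun f z) 1 \<le> 1 / 2"
  shows "f dvd 1"
proof -
  have "dist (disk_ext f z) 1 \<le> 1 / 2" if z: "z \<in> cball 0 1" for z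
  proof (rule continuous_le_on_closure[of "ball 0 1" "\<lambda>z. dist (disk_ext f z) 1"])
    show "continuous_on (closure (ball 0 1)) (\<lambda>z. dist (disk_ext f z) 1)"
      using continuous_on_disk_ext[of f] by (simp add: continuous_on_dist)
    show "z \<in> closure (ball 0 1)" using z by simp
    show "dist (disk_ext f w) 1 \<le> 1 / 2" if "w \<in> ball 0 1" for w
      using near[OF that] disk_ext_eq[OF that] by simp
  qed
  then have nz: "disk_ext f z \<noteq> 0" if "z \<in> cball 0 1" for z
    using that by fastforce
  have inv: "disk_fun (disk_of (\<lambda>z. inverse (disk_ext f z))) z = inverse (disk_ext f z)"
    if "z \<in> ball 0 1" for z
  proof (rule disk_fun_disk_of[OF _ _ that])
    show "continuous_on (cball 0 1) (\<lambda>z. inverse (disk_ext f z))"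
      using nz by (intro continuous_on_inverse continuous_on_disk_ext) simp
    show "(\<lambda>z. inverse (disk_ext f z)) holomorphic_on ball 0 1"
      using nz by (intro holomorphic_on_inverse holomorphic_on_disk_ext) simp
  qed
  have "1 = f * disk_of (\<lambda>z. inverse (disk_ext f z))"
  proof (rule disk_algebra_eqI)
    fix z :: complex assume z: "z \<in> ball 0 1"
    have "disk_fun f z * inverse (disk_ext f z) = 1"
      using nz[of z] z disk_ext_eq[OF z, of f] by simp
    then show "disk_fun 1 z = disk_fun (f * disk_of (\<lambda>z. inverse (disk_ext f z))) z"
      using z by (simp add: times_disk_algebra.rep_eq one_disk_algebra.rep_eq inv)
  qed
  then show ?thesis by (rule dvdI)
qed

section \<open>The path of dilates\<close>

lemma continuous_on_det:
  assumes "\<And>x. A x \<in> carrier_mat n n"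
    and "\<And>i j. i < n \<Longrightarrow> j < n \<Longrightarrow> continuous_on S (\<lambda>x. A x $$ (i, j) :: complex)"
  shows "continuous_on S (\<lambda>x. det (A x))"
proof -
  have "det (A x) = (\<Sum>p\<in>{p. p permutes {0..<n}}. signof p * (\<Prod>i = 0..<n. A x $$ (i, p i)))" for x
    using assms(1) by (rule det_def')
  moreover have "continuous_on S (\<lambda>x. A x $$ (i, p i))" if "p permutes {0..<n}" "i \<in> {0..<n}" for p i
    using that permutes_in_image[OF that(1), of i] by (intro assms(2)) auto
  ultimately show ?thesis
    by (auto intro!: continuous_intros)
qed

text \<open>The leading minors of \<open>F(w)\<inverse> F(w')\<close> are continuous functions of the pair \<open>(w, w')\<close> in a compact
bidisk, and they equal one at \<open>w = w'\<close>. By uniform continuity they stay close to one at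
\<open>(w, w') = (s z, t z)\<close>, uniformly in \<open>z\<close>, when \<open>s\<close> and \<open>t\<close> are close.\<close>
lemma leading_minors_unit_of_close_dilates:
  assumes F: "F \<in> carrier_mat n n" and H: "H \<in> carrier_mat n n" and HF: "H * F = 1\<^sub>m n"
  obtains \<delta> where "\<delta> > 0"
    "\<And>s t k. s \<in> {0..1} \<Longrightarrow> t \<in> {0..1} \<Longrightarrow> \<bar>s - t\<bar> < \<delta> \<Longrightarrow> k \<le> n \<Longrightarrow>
       det (leading_block k (map_mat (dilate s) H * map_mat (dilate t) F)) dvd 1"
proof -
  define \<Phi> where "\<Phi> k w = det (leading_block k
    (map_mat (\<lambda>f. disk_ext f (fst w)) H * map_mat (\<lambda>f. disk_ext f (snd w)) F))" for k w
  let ?K = "cball 0 1 \<times> cball (0::complex) 1"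
  have cont: "continuous_on ?K (\<Phi> k)" if "k \<le> n" for k
    unfolding \<Phi>_def
  proof (rule continuous_on_det)
    fix i j assume ij: "i < k" "j < k"
    have "leading_block k (map_mat (\<lambda>f. disk_ext f (fst w)) H * map_mat (\<lambda>f. disk_ext f (snd w)) F) $$ (i, j)
      = (\<Sum>l = 0..<n. disk_ext (H $$ (i, l)) (fst w) * disk_ext (F $$ (l, j)) (snd w))" for w
      using ij that F H by (simp add: leading_block_def scalar_prod_def)
    moreover have "continuous_on ?K (\<lambda>w. disk_ext f (fst w))" "continuous_on ?K (\<lambda>w. disk_ext f (snd w))" for f
      by (auto intro!: continuous_on_compose2[OF continuous_on_disk_ext] continuous_intros)
    ultimately show "continuous_on ?K (\<lambda>w. leading_block k (map_mat (\<lambda>f. disk_ext f (fst w)) H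
        * map_mat (\<lambda>f. disk_ext f (snd w)) F) $$ (i, j))"
      by (auto intro!: continuous_intros)
  qed (simp add: leading_block_def)
  have diag: "\<Phi> k (w, w) = 1" if w: "w \<in> ball 0 1" and k: "k \<le> n" for k w
  proof -
    interpret comm_ring_hom "\<lambda>f. disk_fun f w" using comm_ring_hom_eval[OF w] .
    have "map_mat (\<lambda>f. disk_fun f w) H * map_mat (\<lambda>f. disk_fun f w) F = 1\<^sub>m n"
      using mat_hom_mult[OF H F] HF mat_hom_one by simp
    moreover have "leading_block k (1\<^sub>m n) = (1\<^sub>m k :: complex mat)"
      using k by (intro eq_matI) (auto simp: leading_block_def)
    ultimately show ?thesis using w by (simp add: \<Phi>_def disk_ext_eq)
  qed
  have "\<exists>d>0. \<forall>w\<in>?K. \<forall>w'\<in>?K. dist w' w < d \<longrightarrow> dist (\<Phi> k w') (\<Phi> k w) < 1 / 2" if "k \<le> n" for k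
  proof -
    have "uniformly_continuous_on ?K (\<Phi> k)"
      using cont[OF that] by (intro compact_uniformly_continuous compact_Times compact_cball)
    then show ?thesis unfolding uniformly_continuous_on_def by (elim allE[of _ "1 / 2"]) simp
  qed
  then obtain d where d: "\<And>k. k \<le> n \<Longrightarrow> d k > 0"
    "\<And>k w w'. k \<le> n \<Longrightarrow> w \<in> ?K \<Longrightarrow> w' \<in> ?K \<Longrightarrow> dist w' w < d k \<Longrightarrow> dist (\<Phi> k w') (\<Phi> k w) < 1 / 2"
    by metis
  \<comment> \<open>One modulus for the minors of all sizes up to n.\<close>
  define \<delta> where "\<delta> = Min (d ` {..n})"
  show thesis
  proof (rule that)
    show "\<delta> > 0" using d(1) by (auto simp: \<delta>_def)
    fix s t :: real and k
    assume st: "s \<in> {0..1}" "t \<in> {0..1}" "\<bar>s - t\<bar> < \<delta>" and k: "k \<le> n"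
    have \<delta>: "\<delta> \<le> d k" using k by (auto simp: \<delta>_def)
    let ?G = "map_mat (dilate s) H * map_mat (dilate t) F"
    show "det (leading_block k ?G) dvd 1"
    proof (rule disk_algebra_unit)
      fix z :: complex assume z: "z \<in> ball 0 1"
      interpret comm_ring_hom "\<lambda>f. disk_fun f z" using comm_ring_hom_eval[OF z] .
      let ?ev = "map_mat (\<lambda>f. disk_fun f z)"
      let ?s = "of_real s * z" and ?t = "of_real t * z"
      have ball: "?s \<in> ball 0 1" "?t \<in> ball 0 1" using st z dilate_in_ball by auto
      have "?ev (leading_block k ?G) = leading_block k (?ev ?G)"
        using F H k by (intro eq_matI) (auto simp: leading_block_def)
      also have "?ev ?G = ?ev (map_mat (dilate s) H) * ?ev (map_mat (dilate t) F)"
        using F H by (intro mat_hom_mult) auto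
      also have "?ev (map_mat (dilate s) H) = map_mat (\<lambda>f. disk_ext f ?s) H"
        using st z ball by (intro eq_matI) (auto simp: disk_fun_dilate disk_ext_eq)
      also have "?ev (map_mat (dilate t) F) = map_mat (\<lambda>f. disk_ext f ?t) F"
        using st z ball by (intro eq_matI) (auto simp: disk_fun_dilate disk_ext_eq)
      finally have "disk_fun (det (leading_block k ?G)) z = \<Phi> k (?s, ?t)"
        by (simp add: \<Phi>_def flip: hom_det)
      moreover have "dist (?s, ?t) (?s, ?s) < d k"
      proof -
        have "dist (?s, ?t) (?s, ?s) = norm ((of_real t - of_real s) * z)"
          by (simp add: dist_Pair_Pair dist_norm algebra_simps)
        also have "\<dots> = \<bar>t - s\<bar> * norm z"
          by (simp add: norm_mult flip: of_real_diff)
        also have "\<dots> \<le> \<bar>t - s\<bar> * 1" using z by (intro mult_left_mono) auto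
        finally show ?thesis using st \<delta> by simp
      qed
      then have "dist (\<Phi> k (?s, ?t)) (\<Phi> k (?s, ?s)) < 1 / 2"
        using ball by (intro d(2)[OF k]) auto
      ultimately show "dist (disk_fun (det (leading_block k ?G)) z) 1 \<le> 1 / 2"
        using diag[OF ball(1) k] by simp
    qed
  qed
qed

theorem corollary1:
  fixes n :: nat
  assumes "n \<ge> 2"
  shows "E_mats n = (SL_mats n :: disk_algebra mat set)"
proof (rule antisym[OF E_mats_subset_SL_mats], rule subsetI)
  fix F :: "disk_algebra mat" assume F_SL: "F \<in> SL_mats n"
  then have F: "F \<in> carrier_mat n n" "det F = 1" by (auto simp: SL_mats_def)
  have n: "n > 0" using assms by simp
  define H where "H = adj_mat F"
  have H: "H \<in> carrier_mat n n" "F * H = 1\<^sub>m n" "H * F = 1\<^sub>m n"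
    using adj_mat[OF F(1)] by (auto simp: H_def F(2))
  have det_H: "det H = 1" using det_mult[OF F(1) H(1)] H(2) F(2) by simp
  obtain \<delta> where \<delta>: "\<delta> > 0"
    "\<And>s t k. s \<in> {0..1} \<Longrightarrow> t \<in> {0..1} \<Longrightarrow> \<bar>s - t\<bar> < \<delta> \<Longrightarrow> k \<le> n \<Longrightarrow>
       det (leading_block k (map_mat (dilate s) H * map_mat (dilate t) F)) dvd 1"
    using leading_minors_unit_of_close_dilates[OF F(1) H(1,3)] by metis
  obtain N where N: "inverse (real (Suc N)) < \<delta>" using reals_Archimedean[OF \<delta>(1)] by auto
  define \<tau> where "\<tau> j = real j / real (Suc N)" for j
  \<comment> \<open>Climb along the path of dilates from the constant matrix F(0) to F, in steps shorter than the modulus of continuity.\<close>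
  have "j \<le> Suc N \<Longrightarrow> map_mat (dilate (\<tau> j)) F \<in> E_mats n" for j
  proof (induction j)
    case 0
    interpret ev: comm_ring_hom "\<lambda>f. disk_fun f 0" by (rule comm_ring_hom_eval) simp
    interpret const: comm_ring_hom disk_const by (rule comm_ring_hom_disk_const)
    let ?C = "map_mat (\<lambda>f. disk_fun f 0) F"
    have "map_mat (dilate (\<tau> 0)) F = map_mat disk_const ?C"
      using F(1) by (intro eq_matI) (auto intro!: disk_algebra_eqI
          simp: \<tau>_def disk_fun_dilate disk_fun_disk_const)
    moreover have "?C \<in> E_mats n"
    proof (rule elem_reducible_SL_mats[OF _ _ n])
      have "det ?C = 1" by (simp add: F(2))
      then show "?C \<in> SL_mats n" "elem_reducible n ?C"
        using F(1) n by (auto simp: SL_mats_def intro!: elem_reducible_field)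
    qed
    ultimately show ?case using const.hom_E_mats by simp
  next
    case (Suc j)
    let ?s = "\<tau> j" and ?t = "\<tau> (Suc j)"
    have st: "?s \<in> {0..1}" "?t \<in> {0..1}" using Suc.prems by (auto simp: \<tau>_def)
    interpret s: comm_ring_hom "dilate ?s" using comm_ring_hom_dilate[OF st(1)] .
    interpret t: comm_ring_hom "dilate ?t" using comm_ring_hom_dilate[OF st(2)] .
    let ?G = "map_mat (dilate ?s) H * map_mat (dilate ?t) F"
    have "\<bar>?s - ?t\<bar> = inverse (real (Suc N))"
      by (simp add: \<tau>_def inverse_eq_divide flip: diff_divide_distrib)
    then have "elem_reducible n ?G"
      using F(1) H(1) N st by (intro elem_reducible_leading_minors[OF _ n] \<delta>(2)) auto
    moreover have "?G \<in> SL_mats n"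
      using F H(1) det_H by (auto simp: SL_mats_def det_mult[of _ n])
    ultimately have "?G \<in> E_mats n" using elem_reducible_SL_mats n by blast
    moreover have "map_mat (dilate ?s) F * ?G = map_mat (dilate ?t) F"
    proof -
      have "map_mat (dilate ?s) F * ?G = (map_mat (dilate ?s) F * map_mat (dilate ?s) H) * map_mat (dilate ?t) F"
        using F(1) H(1) by (simp add: assoc_mult_mat[of _ n n _ n _ n])
      also have "map_mat (dilate ?s) F * map_mat (dilate ?s) H = 1\<^sub>m n"
        using s.mat_hom_mult[OF F(1) H(1)] H(2) s.mat_hom_one by simp
      finally show ?thesis using F(1) by simp
    qed
    ultimately show ?case using Suc E_mats_mult by (metis Suc_leD)
  qed
  from this[of "Suc N"] have "map_mat (dilate 1) F \<in> E_mats n" by (simp add: \<tau>_def)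
  moreover have "map_mat (dilate 1) F = F"
    by (intro eq_matI) (auto intro!: disk_algebra_eqI simp: disk_fun_dilate)
  ultimately show "F \<in> E_mats n" by simp
qed

end
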